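(* Let $G=(V_1\cup V_2,E)$ be a connected bipartite graph with stable sets $V_1,V_2$, $n=n_1+n_2$ vertices where $n_1=|V_1|$, $n_2=|V_2|$, and diameter $D\ge 2$. Then its semi-double graph $G^{2V_1}$, which has $2n_1+n_2$ vertices, has diameter $D$, and its spectrum consists of the values $\sqrt{2}\,\lambda$ for each eigenvalue $\lambda$ of $G$ (counted with multiplicity), together with the eigenvalue $0$ with additional multiplicity $n_1$.
   Context: The semi-double graph $G^{2V_1}$ of a bipartite graph $G$ with stable sets $V_1,V_2$ is obtained by adding, for each vertex $u\in V_1$, a new vertex $u'$ whose neighbourhood equals the neighbourhood of $u$ in $G$; it is bipartite with stable sets $V_1\cup V_1'$ and $V_2$. The spectrum of a graph is the multiset of eigenvalues of its adjacency matrix. *)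

theory Defs
  imports
    "Graph_Theory.Digraph_Component"
    "Graph_Theory.Shortest_Path"
    "Jordan_Normal_Form.Char_Poly"
begin

text \<open>
  A finite simple graph is a \<^const>\<open>pair_graph\<close>, i.e. a finite, loop-free, symmetric
  digraph without parallel arcs; the edge \<open>uv\<close> is the pair of arcs \<open>(u, v)\<close>, \<open>(v, u)\<close>.
\<close>

definition bipartition :: "'a pair_pre_digraph \<Rightarrow> 'a set \<Rightarrow> 'a set \<Rightarrow> bool" where
  "bipartition G V1 V2 \<longleftrightarrow>
     pverts G = V1 \<union> V2 \<and> V1 \<inter> V2 = {} \<and>
     (\<forall>(u, v) \<in> parcs G. \<not> (u \<in> V1 \<and> v \<in> V1) \<and> \<not> (u \<in> V2 \<and> v \<in> V2))"

definition graph_dist :: "'a pair_pre_digraph \<Rightarrow> 'a \<Rightarrow> 'a \<Rightarrow> ereal" where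
  "graph_dist G u v = wf_digraph.\<mu> (with_proj G) (\<lambda>_. 1) u v"

definition graph_diameter :: "'a pair_pre_digraph \<Rightarrow> ereal" where
  "graph_diameter G = (SUP u \<in> pverts G. SUP v \<in> pverts G. graph_dist G u v)"

text \<open>\<open>Inl v\<close> is the original vertex \<open>v\<close> and \<open>Inr u\<close> is the new vertex \<open>u'\<close>, for \<open>u \<in> V1\<close>.\<close>

definition semi_double :: "'a pair_pre_digraph \<Rightarrow> 'a set \<Rightarrow> ('a + 'a) pair_pre_digraph" where
  "semi_double G V1 =
     \<lparr> pverts = Inl ` pverts G \<union> Inr ` V1,
       parcs = {(Inl u, Inl v) | u v. (u, v) \<in> parcs G}
             \<union> {(Inr u, Inl v) | u v. u \<in> V1 \<and> (u, v) \<in> parcs G}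
             \<union> {(Inl v, Inr u) | u v. u \<in> V1 \<and> (v, u) \<in> parcs G} \<rparr>"

text \<open>
  The matrix is taken over \<open>\<complex>\<close>, so that the roots of its characteristic polynomial,
  counted with multiplicity, are all of its eigenvalues without appeal to symmetry.
\<close>

definition adjacency_matrix :: "'a list \<Rightarrow> 'a pair_pre_digraph \<Rightarrow> complex mat" where
  "adjacency_matrix vs G =
     mat (length vs) (length vs) (\<lambda>(i, j). if (vs ! i, vs ! j) \<in> parcs G then 1 else 0)"

text \<open>The choice of the enumeration is immaterial: see \<open>graph_spectrum_eq\<close> below.\<close>

definition graph_spectrum :: "'a pair_pre_digraph \<Rightarrow> complex multiset" where
  "graph_spectrum G =
     proots (char_poly (adjacency_matrix (SOME vs. distinct vs \<and> set vs = pverts G) G))"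

lemma sum_nth_distinct_delta:
  fixes f :: "'a \<Rightarrow> 'b :: comm_monoid_add"
  assumes "distinct ws" "a \<in> set ws"
  shows "(\<Sum>k = 0..<length ws. if a = ws ! k then f (ws ! k) else 0) = f a"
proof -
  have "(\<Sum>k = 0..<length ws. if a = ws ! k then f (ws ! k) else 0)
      = (\<Sum>x \<in> set ws. if a = x then f x else 0)"
    using assms(1) by (intro sum.reindex_bij_betw bij_betw_nth) auto
  also have "\<dots> = f a"
    using assms(2) by simp
  finally show ?thesis .
qed

lemma char_poly_adjacency_matrix_reorder:
  assumes "distinct vs" "distinct ws" "set vs = set ws"
  shows "char_poly (adjacency_matrix vs G) = char_poly (adjacency_matrix ws G)"
proof -
  define n where "n = length vs"
  have n: "length vs = n" "length ws = n"
    unfolding n_def using assms by (metis distinct_card)+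
  define P :: "complex mat" where "P = mat n n (\<lambda>(i, j). if vs ! i = ws ! j then 1 else 0)"
  define Q :: "complex mat" where "Q = mat n n (\<lambda>(i, j). if ws ! i = vs ! j then 1 else 0)"
  define A where "A = adjacency_matrix vs G"
  define B where "B = adjacency_matrix ws G"
  have car: "P \<in> carrier_mat n n" "Q \<in> carrier_mat n n" "A \<in> carrier_mat n n" "B \<in> carrier_mat n n"
    by (auto simp: P_def Q_def A_def B_def adjacency_matrix_def n)
  have vsi: "vs ! i \<in> set ws" if "i < n" for i
    using that assms(3) n by (metis nth_mem)
  have wsi: "ws ! i \<in> set vs" if "i < n" for i
    using that assms(3) n by (metis nth_mem)
  have PQ: "P * Q = 1\<^sub>m n"
  proof (rule eq_matI)
    fix i j assume "i < dim_row (1\<^sub>m n :: complex mat)" "j < dim_col (1\<^sub>m n :: complex mat)"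
    then have ij: "i < n" "j < n" by auto
    have "(P * Q) $$ (i, j) = (\<Sum>k = 0..<length ws. P $$ (i, k) * Q $$ (k, j))"
      using ij car by (simp add: scalar_prod_def n)
    also have "\<dots> = (\<Sum>k = 0..<length ws. if vs ! i = ws ! k
        then (\<lambda>x. if x = vs ! j then 1 else 0) (ws ! k) else 0)"
      using ij by (intro sum.cong) (auto simp: P_def Q_def n)
    also have "\<dots> = (if vs ! i = vs ! j then 1 else 0)"
      by (subst sum_nth_distinct_delta) (use assms vsi ij in auto)
    also have "\<dots> = 1\<^sub>m n $$ (i, j)"
      using ij n assms(1) by (auto simp: nth_eq_iff_index_eq)
    finally show "(P * Q) $$ (i, j) = 1\<^sub>m n $$ (i, j)" .
  qed (use car in auto)
  have QP: "Q * P = 1\<^sub>m n"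
    using PQ car mat_mult_left_right_inverse by blast
  have PB: "P * B = A * P"
  proof (rule eq_matI)
    fix i j assume "i < dim_row (A * P)" "j < dim_col (A * P)"
    then have ij: "i < n" "j < n" using car by auto
    have "(P * B) $$ (i, j) = (\<Sum>k = 0..<length ws. P $$ (i, k) * B $$ (k, j))"
      using ij car by (simp add: scalar_prod_def n)
    also have "\<dots> = (\<Sum>k = 0..<length ws. if vs ! i = ws ! k
        then (\<lambda>x. if (x, ws ! j) \<in> parcs G then 1 else 0) (ws ! k) else 0)"
      using ij by (intro sum.cong) (auto simp: P_def B_def adjacency_matrix_def n)
    also have "\<dots> = (if (vs ! i, ws ! j) \<in> parcs G then 1 else 0)"
      by (subst sum_nth_distinct_delta) (use assms vsi ij in auto)
    also have "\<dots> = (\<Sum>k = 0..<length vs. if ws ! j = vs ! k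
        then (\<lambda>x. if (vs ! i, x) \<in> parcs G then 1 else 0) (vs ! k) else 0)"
      by (subst sum_nth_distinct_delta) (use assms wsi ij in auto)
    also have "\<dots> = (\<Sum>k = 0..<length vs. A $$ (i, k) * P $$ (k, j))"
      using ij by (intro sum.cong) (auto simp: P_def A_def adjacency_matrix_def n)
    also have "\<dots> = (A * P) $$ (i, j)"
      using ij car by (simp add: scalar_prod_def n)
    finally show "(P * B) $$ (i, j) = (A * P) $$ (i, j)" .
  qed (use car in auto)
  have "P * B * Q = A * (P * Q)"
    unfolding PB using car by (simp add: assoc_mult_mat[of _ n n _ n _ n])
  then have "A = P * B * Q"
    using PQ car by simp
  then have "similar_mat_wit A B P Q"
    using PQ QP car by (intro similar_mat_witI[of _ _ n]) auto
  then show ?thesis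
    unfolding A_def B_def by (intro char_poly_similar) (auto simp: similar_mat_def)
qed

lemma graph_spectrum_eq:
  assumes "distinct vs" "set vs = pverts G"
  shows "graph_spectrum G = proots (char_poly (adjacency_matrix vs G))"
proof -
  let ?ws = "SOME ws. distinct ws \<and> set ws = pverts G"
  have "distinct ?ws \<and> set ?ws = pverts G"
    by (rule someI[of _ vs]) (use assms in auto)
  then show ?thesis
    unfolding graph_spectrum_def
    using assms by (simp add: char_poly_adjacency_matrix_reorder[of ?ws vs])
qed

lemma semi_double_pair_graph:
  assumes "pair_graph G" "V1 \<subseteq> pverts G"
  shows "pair_graph (semi_double G V1)"
proof -
  interpret pair_graph G by fact
  have fin: "finite (pverts (semi_double G V1))"
    using assms(2) by (auto simp: semi_double_def intro: finite_subset)
  have sub: "parcs (semi_double G V1) \<subseteq> pverts (semi_double G V1) \<times> pverts (semi_double G V1)"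
    by (auto simp: semi_double_def dest: in_arcsD1 in_arcsD2)
  have sym: "(v, u) \<in> parcs G" if "(u, v) \<in> parcs G" for u v
    using that sym_arcs by (auto simp: symmetric_def dest: symD)
  show ?thesis
  proof
    show "finite (parcs (semi_double G V1))"
      using sub fin by (meson finite_SigmaI finite_subset)
    show "symmetric (with_proj (semi_double G V1))"
      unfolding symmetric_def by (auto simp: semi_double_def sym intro!: symI)
  qed (use fin in \<open>auto simp: semi_double_def dest: no_loops' in_arcsD1 in_arcsD2\<close>)
qed

lemma semi_double_bipartition:
  assumes "bipartition G V1 V2"
  shows "bipartition (semi_double G V1) (Inl ` V1 \<union> Inr ` V1) (Inl ` V2)"
  using assms by (fastforce simp: bipartition_def semi_double_def)

end

theory Submission
  imports Defs "Jordan_Normal_Form.Schur_Decomposition"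
begin

text \<open>
  Projecting \<open>u'\<close> to \<open>u\<close> maps walks of the semi-double graph to walks of \<open>G\<close> of the same length, and
  a nonempty walk of \<open>G\<close> lifts to one of the same length between any prescribed lifts of its
  endpoints; so the only new distances are \<open>d(u, u') = 2\<close>, and the diameter is unchanged when it
  is at least \<open>2\<close>.

  For the spectrum, list the new vertices first. The rows and the columns of \<open>u'\<close> and \<open>u\<close> in the
  adjacency matrix agree, so subtracting row \<open>u\<close> from row \<open>u'\<close> and then adding column \<open>u'\<close> to
  column \<open>u\<close> is a similarity to a block triangular matrix with diagonal blocks \<open>0\<close> and \<open>A'\<close>, where
  \<open>A'\<close> is the adjacency matrix \<open>A\<close> of \<open>G\<close> with the columns of \<open>V1\<close> doubled. Since \<open>A\<close> only has
  entries between \<open>V1\<close> and \<open>V2\<close>, a diagonal matrix conjugates \<open>A'\<close> to \<open>sqrt 2 * A\<close>.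
\<close>

section \<open>Distances\<close>

lemma (in wf_digraph) awalk_cost_one: "awalk_cost (\<lambda>_. 1) p = real (length p)"
  by (induct p) auto

text \<open>Unit arc costs make the cost of a walk its length, so later bounds on distances only
  compare lengths of walks. If no walk exists, the infimum is over the empty set and equals
  \<infinity>.\<close>

lemma graph_dist_eq_INF_length:
  assumes "pair_graph G"
  shows "graph_dist G u v =
    (INF p \<in> {p. pre_digraph.awalk (with_proj G) u p v}. ereal (real (length p)))"
proof -
  interpret pair_graph G by fact
  show ?thesis
    by (simp add: graph_dist_def \<mu>_def awalk_cost_one)
qed

lemma graph_dist_le_awalk:
  assumes "pair_graph G" "pre_digraph.awalk (with_proj G) u p v"
  shows "graph_dist G u v \<le> ereal (real (length p))"
  unfolding graph_dist_eq_INF_length[OF assms(1)] by (rule INF_lower) (use assms in auto)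

lemma graph_dist_geI:
  assumes "pair_graph G"
    and "\<And>p. pre_digraph.awalk (with_proj G) u p v \<Longrightarrow> c \<le> ereal (real (length p))"
  shows "c \<le> graph_dist G u v"
  unfolding graph_dist_eq_INF_length[OF assms(1)] by (rule INF_greatest) (use assms in auto)

lemma graph_dist_le_diameter:
  assumes "u \<in> pverts G" "v \<in> pverts G"
  shows "graph_dist G u v \<le> graph_diameter G"
  unfolding graph_diameter_def using assms by (intro SUP_upper2[of u] SUP_upper) auto

lemma graph_diameter_leI:
  assumes "\<And>u v. u \<in> pverts G \<Longrightarrow> v \<in> pverts G \<Longrightarrow> graph_dist G u v \<le> c"
  shows "graph_diameter G \<le> c"
  unfolding graph_diameter_def using assms by (intro SUP_least) auto

text \<open>If \<open>u\<close> were the only vertex, the empty walk would force diameter at most 0.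
  So there is another vertex, and the first arc of a walk to it supplies \<open>w\<close>. The
  neighbour is needed for the closed walk \<open>u\<close>, \<open>w\<close>, \<open>u\<close> that
  joins the lifts of \<open>u\<close>.\<close>

lemma ex_neighbour:
  assumes "pair_graph G" "Digraph_Component.connected (with_proj G)" "0 < graph_diameter G"
    and "u \<in> pverts G"
  obtains w where "(u, w) \<in> parcs G"
proof -
  interpret pair_graph G by fact
  have "\<exists>v \<in> pverts G. v \<noteq> u"
  proof (rule ccontr)
    assume "\<not> ?thesis"
    then have single: "v = u" if "v \<in> pverts G" for v
      using that by auto
    have "awalk u [] u"
      using assms(4) by (simp add: awalk_Nil_iff)
    then have "graph_dist G u u \<le> 0"
      using graph_dist_le_awalk[OF assms(1), of u "[]" u] by (simp add: zero_ereal_def)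
    then have "graph_diameter G \<le> 0"
      by (intro graph_diameter_leI) (metis single)
    with assms(3) show False by simp
  qed
  then obtain v where v: "v \<in> pverts G" "v \<noteq> u" by auto
  have "strongly_connected (with_proj G)"
    by (rule symmetric_connected_imp_strongly_connected[OF sym_arcs assms(2)])
  then have "u \<rightarrow>\<^sup>*\<^bsub>with_proj G\<^esub> v"
    using assms(4) v by (auto elim!: strongly_connectedE)
  then obtain p where p: "awalk u p v"
    by (auto simp: reachable_awalk)
  with v obtain e q where "p = e # q"
    by (cases p) (auto simp: awalk_Nil_iff)
  with p have "(u, snd e) \<in> parcs G"
    by (cases e) (auto simp: awalk_Cons_iff)
  then show thesis by (rule that)
qed

section \<open>Projecting and lifting walks\<close>

fun semi_double_proj :: "'a + 'a \<Rightarrow> 'a" where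
  "semi_double_proj (Inl v) = v"
| "semi_double_proj (Inr v) = v"

text \<open>The only delicate case is two new vertices: \<open>semi_double\<close> puts no arc
  between them, and their projections are not adjacent either because \<open>V1\<close> is
  stable.\<close>

lemma semi_double_arc_iff:
  assumes "bipartition G V1 V2" "x \<in> pverts (semi_double G V1)" "y \<in> pverts (semi_double G V1)"
  shows "(x, y) \<in> parcs (semi_double G V1) \<longleftrightarrow>
    (semi_double_proj x, semi_double_proj y) \<in> parcs G"
  using assms by (cases x; cases y) (auto simp: semi_double_def bipartition_def)

lemma semi_double_proj_verts:
  assumes "V1 \<subseteq> pverts G" "x \<in> pverts (semi_double G V1)"
  shows "semi_double_proj x \<in> pverts G"
  using assms by (auto simp: semi_double_def)

lemma awalk_semi_double_proj:
  assumes "pair_graph G" "bipartition G V1 V2"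
    and "pre_digraph.awalk (with_proj (semi_double G V1)) x p y"
  shows "pre_digraph.awalk (with_proj G) (semi_double_proj x)
    (map (map_prod semi_double_proj semi_double_proj) p) (semi_double_proj y)"
proof -
  have sub: "V1 \<subseteq> pverts G"
    using assms(2) by (auto simp: bipartition_def)
  interpret G: pair_graph G by fact
  interpret S: pair_graph "semi_double G V1"
    by (rule semi_double_pair_graph[OF assms(1) sub])
  show ?thesis
    using assms(3)
  proof (induct p arbitrary: x)
    case Nil
    then show ?case
      by (auto simp: G.awalk_Nil_iff S.awalk_Nil_iff semi_double_proj_verts[OF sub])
  next
    case (Cons e p)
    obtain z where e: "e = (x, z)" and arc: "(x, z) \<in> parcs (semi_double G V1)"
      and p: "S.awalk z p y"
      using Cons.prems by (cases e) (auto simp: S.awalk_Cons_iff)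
    have "(semi_double_proj x, semi_double_proj z) \<in> parcs G"
      using arc semi_double_arc_iff[OF assms(2)] S.in_arcsD1 S.in_arcsD2 by blast
    then show ?case
      using Cons.hyps[OF p] by (simp add: e G.awalk_Cons_iff)
  qed
qed

text \<open>Only the endpoints are prescribed; every interior vertex \<open>w\<close> is lifted to
  \<open>Inl w\<close>. The walk must be nonempty, since the empty walk at \<open>u\<close> has no
  lift from \<open>Inl u\<close> to \<open>Inr u\<close>.\<close>

lemma awalk_semi_double_lift:
  assumes "pair_graph G" "bipartition G V1 V2"
    and "pre_digraph.awalk (with_proj G) (semi_double_proj x) p (semi_double_proj y)" "p \<noteq> []"
    and "x \<in> pverts (semi_double G V1)" "y \<in> pverts (semi_double G V1)"
  shows "\<exists>q. pre_digraph.awalk (with_proj (semi_double G V1)) x q y \<and> length q = length p"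
proof -
  have sub: "V1 \<subseteq> pverts G"
    using assms(2) by (auto simp: bipartition_def)
  interpret G: pair_graph G by fact
  interpret S: pair_graph "semi_double G V1"
    by (rule semi_double_pair_graph[OF assms(1) sub])
  note arc_iff = semi_double_arc_iff[OF assms(2)]
  show ?thesis
    using assms(3-5)
  proof (induct p arbitrary: x)
    case Nil
    then show ?case by simp
  next
    case (Cons e p)
    obtain w where e: "e = (semi_double_proj x, w)" and arc: "(semi_double_proj x, w) \<in> parcs G"
      and p: "G.awalk w p (semi_double_proj y)"
      using Cons.prems(1) by (cases e) (auto simp: G.awalk_Cons_iff)
    show ?case
    proof (cases "p = []")
      case True
      then have "w = semi_double_proj y"
        using p by (simp add: G.awalk_Nil_iff)
      then have "S.awalk x [(x, y)] y"
        using arc arc_iff Cons.prems(3) assms(6)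
        by (simp add: S.awalk_Cons_iff S.awalk_Nil_iff)
      then show ?thesis
        using True by (intro exI[of _ "[(x, y)]"]) simp
    next
      case False
      \<comment> \<open>The induction hypothesis is used with the lift \<open>Inl w\<close> of the
        second vertex as new starting point, which is why \<open>x\<close> is generalized.\<close>
      have w: "Inl w \<in> pverts (semi_double G V1)"
        using arc by (auto simp: semi_double_def dest: G.in_arcsD2)
      obtain q where q: "S.awalk (Inl w) q y" "length q = length p"
        using Cons.hyps[of "Inl w"] p False w by auto
      have "(x, Inl w) \<in> parcs (semi_double G V1)"
        using arc arc_iff[OF Cons.prems(3) w] by simp
      then have "S.awalk x ((x, Inl w) # q) y"
        using q by (simp add: S.awalk_Cons_iff)
      then show ?thesis
        using q by (intro exI[of _ "(x, Inl w) # q"]) simp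
    qed
  qed
qed

lemma graph_diameter_semi_double:
  assumes "pair_graph G" "Digraph_Component.connected (with_proj G)" "bipartition G V1 V2"
    and "2 \<le> graph_diameter G"
  shows "graph_diameter (semi_double G V1) = graph_diameter G"
proof (rule antisym)
  have sub: "V1 \<subseteq> pverts G"
    using assms(3) by (auto simp: bipartition_def)
  have pgS: "pair_graph (semi_double G V1)"
    by (rule semi_double_pair_graph[OF assms(1) sub])
  interpret G: pair_graph G by fact
  interpret S: pair_graph "semi_double G V1" by fact
  have pos: "0 < graph_diameter G"
    using assms(4) by (rule less_le_trans[rotated]) simp
  show "graph_diameter G \<le> graph_diameter (semi_double G V1)"
  proof (rule graph_diameter_leI)
    fix u v assume uv: "u \<in> pverts G" "v \<in> pverts G"
    have "graph_dist G u v \<le> graph_dist (semi_double G V1) (Inl u) (Inl v)"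
    proof (rule graph_dist_geI[OF pgS])
      fix p assume "S.awalk (Inl u) p (Inl v)"
      from awalk_semi_double_proj[OF assms(1,3) this]
      show "graph_dist G u v \<le> ereal (real (length p))"
        using graph_dist_le_awalk[OF assms(1)] by fastforce
    qed
    also have "\<dots> \<le> graph_diameter (semi_double G V1)"
      by (rule graph_dist_le_diameter) (use uv in \<open>auto simp: semi_double_def\<close>)
    finally show "graph_dist G u v \<le> graph_diameter (semi_double G V1)" .
  qed
  show "graph_diameter (semi_double G V1) \<le> graph_diameter G"
  proof (rule graph_diameter_leI)
    fix x y assume xy: "x \<in> pverts (semi_double G V1)" "y \<in> pverts (semi_double G V1)"
    let ?u = "semi_double_proj x" and ?v = "semi_double_proj y"
    have uv: "?u \<in> pverts G" "?v \<in> pverts G"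
      using xy semi_double_proj_verts[OF sub] by auto
    have lift: "graph_dist (semi_double G V1) x y \<le> ereal (real (length p))"
      if "G.awalk ?u p ?v" "p \<noteq> []" for p
      using awalk_semi_double_lift[OF assms(1,3) that xy] graph_dist_le_awalk[OF pgS] by metis
    show "graph_dist (semi_double G V1) x y \<le> graph_diameter G"
    proof (cases "?u = ?v")
      case True
      \<comment> \<open>Here \<open>x\<close> and \<open>y\<close> are lifts of one vertex. The
        closed walk through a neighbour is nonempty, hence lifts to a walk of length 2 from
        \<open>x\<close> to \<open>y\<close>; this is where the bound 2 on the diameter
        enters.\<close>
      obtain w where w: "(?u, w) \<in> parcs G"
        using ex_neighbour[OF assms(1,2) pos uv(1)] .
      then have "(w, ?u) \<in> parcs G"
        using G.sym_arcs by (auto simp: symmetric_def dest: symD)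
      then have "G.awalk ?u [(?u, w), (w, ?u)] ?v"
        using w True uv by (simp add: G.awalk_Cons_iff G.awalk_Nil_iff)
      from lift[OF this] have "graph_dist (semi_double G V1) x y \<le> 2"
        by simp
      then show ?thesis
        using assms(4) by (rule order_trans)
    next
      case False
      \<comment> \<open>As the projections differ, every walk between them is nonempty, so each walk
        in the infimum for \<open>G\<close> can be lifted.\<close>
      have "graph_dist (semi_double G V1) x y \<le> graph_dist G ?u ?v"
        by (rule graph_dist_geI[OF assms(1)], rule lift)
          (use False in \<open>auto simp: G.awalk_Nil_iff\<close>)
      also have "\<dots> \<le> graph_diameter G"
        by (rule graph_dist_le_diameter) (use uv in auto)
      finally show ?thesis .
    qed
  qed
qed

section \<open>Characteristic polynomials\<close>

lemma proots_prod_list_linear: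
  fixes as :: "'a :: idom list"
  shows "proots (\<Prod>a\<leftarrow>as. [:- a, 1:]) = mset as"
proof (induct as)
  case (Cons a as)
  have "(\<Prod>a\<leftarrow>as. [:- a, 1:]) \<noteq> 0"
    by (auto simp: prod_list_zero_iff)
  then have "proots ([:- a, 1:] * (\<Prod>a\<leftarrow>as. [:- a, 1:])) = {#a#} + mset as"
    using Cons by (subst proots_mult) (simp_all only: proots_linear_factor, auto)
  then show ?case
    by (simp only: list.map prod_list.Cons mset.simps) simp
qed simp

text \<open>Over the complex numbers \<open>A\<close> is similar to an upper triangular matrix,
  whose eigenvalues with multiplicity are its diagonal entries; scaling by \<open>c\<close>
  preserves the similarity and scales that diagonal.\<close>

lemma proots_char_poly_smult:
  fixes A :: "complex mat"
  assumes A: "A \<in> carrier_mat n n"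
  shows "proots (char_poly (c \<cdot>\<^sub>m A)) = image_mset ((*) c) (proots (char_poly A))"
proof -
  obtain as where "char_poly A = (\<Prod>a\<leftarrow>as. [:- a, 1:])"
    using char_poly_factorized[OF A] by auto
  from schur_decomposition_exists[OF A this]
  obtain B where B: "B \<in> carrier_mat n n" "upper_triangular B" "similar_mat A B" by auto
  have "upper_triangular (c \<cdot>\<^sub>m B)"
    using B(1,2) by (auto simp: upper_triangular_def)
  then have "char_poly (c \<cdot>\<^sub>m B) = (\<Prod>a\<leftarrow>diag_mat (c \<cdot>\<^sub>m B). [:- a, 1:])"
    using B(1) by (intro char_poly_upper_triangular) auto
  moreover have "diag_mat (c \<cdot>\<^sub>m B) = map ((*) c) (diag_mat B)"
    using B(1) by (auto simp: diag_mat_def)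
  moreover have "char_poly (c \<cdot>\<^sub>m A) = char_poly (c \<cdot>\<^sub>m B)" "char_poly A = char_poly B"
    by (rule char_poly_similar[OF similar_mat_smult[OF B(3)]], rule char_poly_similar[OF B(3)])
  moreover have "char_poly B = (\<Prod>a\<leftarrow>diag_mat B. [:- a, 1:])"
    using B by (intro char_poly_upper_triangular) auto
  ultimately show ?thesis
    by (simp add: proots_prod_list_linear del: map_map)
qed

lemma proots_char_poly_zero_mat:
  "proots (char_poly (0\<^sub>m m m :: 'a :: idom mat)) = replicate_mset m 0"
proof -
  have "char_poly (0\<^sub>m m m :: 'a mat) = (\<Prod>a\<leftarrow>diag_mat (0\<^sub>m m m). [:- a, 1:])"
    by (rule char_poly_upper_triangular[of _ m]) auto
  moreover have "diag_mat (0\<^sub>m m m :: 'a mat) = replicate m 0"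
    by (rule nth_equalityI) (auto simp: diag_mat_def)
  ultimately show ?thesis
    by (simp only: proots_prod_list_linear mset_replicate)
qed

text \<open>Conjugation by the unipotent block matrix \<open>?P\<close>, with inverse
  \<open>?Q\<close>, turns \<open>?M\<close> into the block lower triangular \<open>?N\<close>,
  whose diagonal blocks give the two factors. In the application \<open>R\<close> and
  \<open>T\<close> select the rows and columns to be duplicated.\<close>

lemma char_poly_duplicated_block:
  fixes A R T :: "complex mat"
  assumes A: "A \<in> carrier_mat n n" and R: "R \<in> carrier_mat m n" and T: "T \<in> carrier_mat n m"
    and RAT: "R * A * T = 0\<^sub>m m m"
  shows "char_poly (four_block_mat (0\<^sub>m m m) (R * A) (A * T) A) =
    char_poly (0\<^sub>m m m :: complex mat) * char_poly (A * T * R + A)"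
proof -
  let ?M = "four_block_mat (0\<^sub>m m m) (R * A) (A * T) A"
  let ?N = "four_block_mat (0\<^sub>m m m) (0\<^sub>m m n) (A * T) (A * T * R + A)"
  let ?P = "four_block_mat (1\<^sub>m m) R (0\<^sub>m n m) (1\<^sub>m n)"
  let ?Q = "four_block_mat (1\<^sub>m m) (- R) (0\<^sub>m n m) (1\<^sub>m n)"
  have AT: "A * T \<in> carrier_mat n m" and RA: "R * A \<in> carrier_mat m n"
    and ATR: "A * T * R \<in> carrier_mat n n" and mR: "- R \<in> carrier_mat m n"
    using A R T by auto
  have D: "A * T * R + A \<in> carrier_mat n n"
    using A by simp
  have RAT': "R * (A * T) = 0\<^sub>m m m"
    using RAT A R T by (simp add: assoc_mult_mat[of R m n A n T m])
  \<comment> \<open>Since \<open>R * A * T\<close> vanishes, the upper right block of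
    \<open>?P * ?N\<close> is already that of \<open>?M\<close>; multiplying by \<open>?Q\<close>
    then only has to correct the lower right block.\<close>
  have RATR: "R * (A * T * R + A) = R * A"
  proof -
    have "R * (A * T * R) = R * (A * T) * R"
      using assoc_mult_mat[OF R AT R] by simp
    also have "\<dots> = 0\<^sub>m m n"
      using R by (simp add: RAT')
    finally show ?thesis
      using RA by (simp add: mult_add_distrib_mat[OF R ATR A])
  qed
  have cancel: "- B + (B + C) = C" if "B \<in> carrier_mat a b" "C \<in> carrier_mat a b"
    for B C :: "complex mat" and a b
    using that by (intro eq_matI) auto
  have cancel_zero: "- R + R = 0\<^sub>m m n" "R + - R = 0\<^sub>m m n"
    "- 0\<^sub>m n n + 1\<^sub>m n = (1\<^sub>m n :: complex mat)"
    using R by (auto intro!: eq_matI)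
  have PQ: "?P * ?Q = 1\<^sub>m (m + n)"
    using R mR cancel_zero by (subst mult_four_block_mat[of _ m m _ n _ n _ _ m _ n]) auto
  have QP: "?Q * ?P = 1\<^sub>m (m + n)"
    using R mR cancel_zero by (subst mult_four_block_mat[of _ m m _ n _ n _ _ m _ n]) auto
  have "?P * ?N = four_block_mat (0\<^sub>m m m) (R * A) (A * T) (A * T * R + A)"
    using A R T AT RA ATR
    by (subst mult_four_block_mat[of _ m m _ n _ n _ _ m _ n])
      (auto simp: RAT' RATR simp del: assoc_mult_mat)
  also have "\<dots> * ?Q = ?M"
  proof -
    have "A * T * - R + (A * T * R + A) * 1\<^sub>m n = - (A * T * R) + (A * T * R + A)"
      using A R T ATR by (simp del: assoc_mult_mat)
    also have "\<dots> = A"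
      by (rule cancel[OF ATR A])
    finally have lower_right: "A * T * - R + (A * T * R + A) * 1\<^sub>m n = A" .
    have others: "0\<^sub>m m m * 1\<^sub>m m + R * A * 0\<^sub>m n m = 0\<^sub>m m m"
      "0\<^sub>m m m * - R + R * A * 1\<^sub>m n = R * A"
      "A * T * 1\<^sub>m m + (A * T * R + A) * 0\<^sub>m n m = A * T"
      using A mR RA AT ATR right_mult_one_mat[OF AT]
      by (simp_all del: assoc_mult_mat uminus_mult_right_mat)
    from mult_four_block_mat[OF zero_carrier_mat RA AT D one_carrier_mat mR zero_carrier_mat
        one_carrier_mat]
    show ?thesis
      by (simp only: lower_right others)
  qed
  finally have M: "?M = ?P * ?N * ?Q" by (rule sym)
  have "similar_mat_wit ?M ?N ?P ?Q"
    by (rule similar_mat_witI[OF PQ QP M]) (rule four_block_carrier_mat; simp add: A D)+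
  then have "char_poly ?M = char_poly ?N"
    by (intro char_poly_similar) (auto simp: similar_mat_def)
  also have "\<dots> = char_poly (0\<^sub>m m m :: complex mat) * char_poly (A * T * R + A)"
    \<comment> \<open>Both diagonal blocks have characteristic polynomials that split into linear
      factors, as \<open>char_poly_0_block'\<close> asks.\<close>
    using char_poly_factorized[of "0\<^sub>m m m" m] char_poly_factorized[OF D]
    by (intro char_poly_0_block'[OF refl _ _ _ AT D]) auto
  finally show ?thesis .
qed

section \<open>Matrices indexed by lists of vertices\<close>

text \<open>Entries depend on the vertices rather than on their positions, so that multiplying by a
  selection matrix becomes an operation on the function \<open>f\<close>.\<close>

definition list_mat :: "('a \<Rightarrow> 'b \<Rightarrow> 'c) \<Rightarrow> 'a list \<Rightarrow> 'b list \<Rightarrow> 'c mat" where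
  "list_mat f xs ys = mat (length xs) (length ys) (\<lambda>(i, j). f (xs ! i) (ys ! j))"

abbreviation selection_mat :: "'a list \<Rightarrow> 'a list \<Rightarrow> complex mat" where
  "selection_mat \<equiv> list_mat (\<lambda>x y. if x = y then 1 else 0)"

lemma list_mat_carrier [simp]: "list_mat f xs ys \<in> carrier_mat (length xs) (length ys)"
  by (simp add: list_mat_def)

lemma list_mat_cong:
  assumes "\<And>x y. x \<in> set xs \<Longrightarrow> y \<in> set ys \<Longrightarrow> f x y = g x y"
  shows "list_mat f xs ys = list_mat g xs ys"
  using assms by (auto simp: list_mat_def)

lemma list_mat_add: "list_mat f xs ys + list_mat g xs ys = list_mat (\<lambda>x y. f x y + g x y) xs ys"
  by (auto simp: list_mat_def)

lemma list_mat_mult: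
  "list_mat f xs ys * list_mat g ys zs =
    list_mat (\<lambda>x z. \<Sum>k = 0..<length ys. f x (ys ! k) * g (ys ! k) z) xs zs"
  by (rule eq_matI) (auto simp: list_mat_def scalar_prod_def)

lemma selection_mat_mult:
  assumes "distinct ys"
  shows "selection_mat xs ys * list_mat f ys zs =
    list_mat (\<lambda>x z. if x \<in> set ys then f x z else 0) xs zs"
proof -
  have "(\<Sum>k = 0..<length ys. (if x = ys ! k then 1 else 0) * f (ys ! k) z) =
      (if x \<in> set ys then f x z else 0)" for x z
  proof (cases "x \<in> set ys")
    case True
    have "(\<Sum>k = 0..<length ys. (if x = ys ! k then 1 else 0) * f (ys ! k) z) =
        (\<Sum>k = 0..<length ys. if x = ys ! k then (\<lambda>y. f y z) (ys ! k) else 0)"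
      by (intro sum.cong) auto
    then show ?thesis
      using True sum_nth_distinct_delta[OF assms True, of "\<lambda>y. f y z"] by simp
  qed (auto intro!: sum.neutral)
  then show ?thesis
    by (simp only: list_mat_mult)
qed

text \<open>Distinctness leaves at most one nonzero summand. The guard matters when
  \<open>zs\<close> is not contained in \<open>ys\<close>: selecting the columns \<open>us\<close>
  and spreading them back over \<open>vs\<close> keeps exactly the columns in \<open>us\<close> and
  zeroes the rest.\<close>

lemma mult_selection_mat:
  assumes "distinct ys"
  shows "list_mat f xs ys * selection_mat ys zs =
    list_mat (\<lambda>x z. if z \<in> set ys then f x z else 0) xs zs"
proof -
  have "(\<Sum>k = 0..<length ys. f x (ys ! k) * (if ys ! k = z then 1 else 0)) =
      (if z \<in> set ys then f x z else 0)" for x z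
  proof (cases "z \<in> set ys")
    case True
    have "(\<Sum>k = 0..<length ys. f x (ys ! k) * (if ys ! k = z then 1 else 0)) =
        (\<Sum>k = 0..<length ys. if z = ys ! k then f x (ys ! k) else 0)"
      by (intro sum.cong) auto
    then show ?thesis
      using True sum_nth_distinct_delta[OF assms True, of "f x"] by simp
  qed (auto intro!: sum.neutral)
  then show ?thesis
    by (simp only: list_mat_mult)
qed

section \<open>The spectrum of the semi-double graph\<close>

abbreviation adj :: "'a pair_pre_digraph \<Rightarrow> 'a \<Rightarrow> 'a \<Rightarrow> complex" where
  "adj G u v \<equiv> if (u, v) \<in> parcs G then 1 else 0"

lemma adjacency_matrix_eq_list_mat: "adjacency_matrix vs G = list_mat (adj G) vs vs"
  by (simp add: adjacency_matrix_def list_mat_def)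

text \<open>Every arc crosses between \<open>V1\<close> and \<open>V2\<close>, so weight 2 on arcs
  into \<open>V1\<close> and weight 1 on arcs out of it can be balanced to sqrt 2 on both by
  rescaling the vertices.\<close>

lemma similar_mat_doubled_columns:
  assumes "bipartition G V1 V2" "set vs = pverts G"
  shows "similar_mat (list_mat (\<lambda>u v. if v \<in> V1 then 2 * adj G u v else adj G u v) vs vs)
    (complex_of_real (sqrt 2) \<cdot>\<^sub>m adjacency_matrix vs G)"
proof -
  define n where "n = length vs"
  define s where "s = complex_of_real (sqrt 2)"
  have s: "s * s = 2" "s \<noteq> 0"
    unfolding s_def of_real_mult[symmetric] by simp_all
  let ?A = "adjacency_matrix vs G"
  let ?B = "list_mat (\<lambda>u v. if v \<in> V1 then 2 * adj G u v else adj G u v) vs vs"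
  \<comment> \<open>Conjugating \<open>s * A\<close> by this diagonal multiplies an arc from
    \<open>V2\<close> to \<open>V1\<close> by \<open>s * s / 1 = 2\<close> and one from
    \<open>V1\<close> to \<open>V2\<close> by \<open>1 * s / s = 1\<close>.\<close>
  define d where "d i = (if vs ! i \<in> V1 then 1 else s)" for i
  have d: "d i \<noteq> 0" for i
    using s by (simp add: d_def)
  have A: "?A \<in> carrier_mat n n" and B: "?B \<in> carrier_mat n n"
    by (simp_all add: n_def adjacency_matrix_eq_list_mat)
  have bip: "(u \<in> V1) \<noteq> (v \<in> V1)" if "(u, v) \<in> parcs G" "u \<in> pverts G" "v \<in> pverts G" for u v
    using that assms(1) by (auto simp: bipartition_def)
  have "?B = mat_diag n d * (s \<cdot>\<^sub>m ?A) * mat_diag n (\<lambda>i. 1 / d i)"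
  proof (rule eq_matI)
    fix i j
    assume "i < dim_row (mat_diag n d * (s \<cdot>\<^sub>m ?A) * mat_diag n (\<lambda>i. 1 / d i))"
      and "j < dim_col (mat_diag n d * (s \<cdot>\<^sub>m ?A) * mat_diag n (\<lambda>i. 1 / d i))"
    then have ij: "i < n" "j < n"
      by (simp_all add: mat_diag_def)
    then have verts: "vs ! i \<in> pverts G" "vs ! j \<in> pverts G"
      unfolding assms(2)[symmetric] n_def by (simp_all add: nth_mem)
    have "(mat_diag n d * (s \<cdot>\<^sub>m ?A) * mat_diag n (\<lambda>i. 1 / d i)) $$ (i, j) =
        d i * (s * ?A $$ (i, j)) * (1 / d j)"
      using ij A
      by (simp add: mat_diag_mult_right[of _ n n] mat_diag_mult_left[of "s \<cdot>\<^sub>m ?A" n n])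
    also have "?A $$ (i, j) = adj G (vs ! i) (vs ! j)"
      using ij by (simp add: n_def adjacency_matrix_def)
    also have "d i * (s * adj G (vs ! i) (vs ! j)) * (1 / d j) =
        (if vs ! j \<in> V1 then 2 * adj G (vs ! i) (vs ! j) else adj G (vs ! i) (vs ! j))"
      using bip[OF _ verts] s by (auto simp: d_def)
    also have "\<dots> = ?B $$ (i, j)"
      using ij by (simp add: n_def list_mat_def)
    finally show "?B $$ (i, j) =
        (mat_diag n d * (s \<cdot>\<^sub>m ?A) * mat_diag n (\<lambda>i. 1 / d i)) $$ (i, j)" by simp
  qed (use A B in \<open>auto simp: mat_diag_def\<close>)
  moreover have "mat_diag n d * mat_diag n (\<lambda>i. 1 / d i) = 1\<^sub>m n"
    "mat_diag n (\<lambda>i. 1 / d i) * mat_diag n d = 1\<^sub>m n"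
    using d by (simp_all add: mat_diag_diag)
  ultimately have "similar_mat_wit ?B (s \<cdot>\<^sub>m ?A) (mat_diag n d) (mat_diag n (\<lambda>i. 1 / d i))"
    using A B by (intro similar_mat_witI[of _ _ n]) auto
  then show ?thesis
    by (auto simp: similar_mat_def s_def)
qed

text \<open>Listing the new vertices first yields the block shape of
  \<open>char_poly_duplicated_block\<close>; the zero block records that no two new vertices are
  adjacent.\<close>

lemma adjacency_matrix_semi_double:
  assumes "bipartition G V1 V2" "set us = V1" "distinct us" "set vs = pverts G" "distinct vs"
  shows "adjacency_matrix (map Inr us @ map Inl vs) (semi_double G V1) =
    four_block_mat (0\<^sub>m (length us) (length us))
      (selection_mat us vs * adjacency_matrix vs G)
      (adjacency_matrix vs G * selection_mat vs us) (adjacency_matrix vs G)"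
proof -
  have sub: "set us \<subseteq> set vs"
    using assms by (auto simp: bipartition_def)
  have RA: "selection_mat us vs * adjacency_matrix vs G = list_mat (adj G) us vs"
    using sub unfolding adjacency_matrix_eq_list_mat selection_mat_mult[OF assms(5)]
    by (intro list_mat_cong) auto
  have AT: "adjacency_matrix vs G * selection_mat vs us = list_mat (adj G) vs us"
    using sub unfolding adjacency_matrix_eq_list_mat mult_selection_mat[OF assms(5)]
    by (intro list_mat_cong) auto
  have mem: "i < length us \<Longrightarrow> us ! i \<in> V1" for i
    using assms(2) by auto
  show ?thesis
    unfolding RA AT
    by (rule eq_matI)
      (auto simp: adjacency_matrix_def list_mat_def nth_append semi_double_def mem)
qed

lemma graph_spectrum_semi_double:
  assumes "pair_graph G" "bipartition G V1 V2"
  shows "graph_spectrum (semi_double G V1) =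
    image_mset ((*) (complex_of_real (sqrt 2))) (graph_spectrum G) + replicate_mset (card V1) 0"
proof -
  interpret pair_graph G by fact
  have sub: "V1 \<subseteq> pverts G"
    using assms(2) by (auto simp: bipartition_def)
  obtain us where us: "set us = V1" "distinct us"
    using finite_distinct_list[of V1] finite_subset[OF sub] by auto
  obtain vs where vs: "set vs = pverts G" "distinct vs"
    using finite_distinct_list[of "pverts G"] by auto
  let ?A = "adjacency_matrix vs G" and ?m = "length us"
  let ?R = "selection_mat us vs" and ?T = "selection_mat vs us"
  have A: "?A \<in> carrier_mat (length vs) (length vs)"
    by (simp add: adjacency_matrix_eq_list_mat)
  \<comment> \<open>This product is the submatrix of \<open>?A\<close> on \<open>V1\<close>, which
    is zero because \<open>V1\<close> is stable.\<close>
  have RAT: "?R * ?A * ?T = 0\<^sub>m ?m ?m"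
  proof -
    have "?R * ?A * ?T = list_mat (\<lambda>_ _. 0) us us"
      using assms(2) us
      unfolding adjacency_matrix_eq_list_mat selection_mat_mult[OF vs(2)] mult_selection_mat[OF vs(2)]
      by (intro list_mat_cong) (auto simp: bipartition_def)
    then show ?thesis
      by (auto simp: list_mat_def)
  qed
  \<comment> \<open>\<open>?A * ?T * ?R\<close> is \<open>?A\<close> with all columns outside
    \<open>V1\<close> set to zero, so adding \<open>?A\<close> doubles exactly the columns of
    \<open>V1\<close>.\<close>
  have "?A * ?T * ?R + ?A =
      list_mat (\<lambda>u v. if v \<in> V1 then 2 * adj G u v else adj G u v) vs vs"
    using sub us vs
    unfolding adjacency_matrix_eq_list_mat mult_selection_mat[OF vs(2)] mult_selection_mat[OF us(2)]
      list_mat_add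
    by (intro list_mat_cong) auto
  then have doubled: "char_poly (?A * ?T * ?R + ?A) = char_poly (complex_of_real (sqrt 2) \<cdot>\<^sub>m ?A)"
    using char_poly_similar[OF similar_mat_doubled_columns[OF assms(2) vs(1)]] by simp
  \<comment> \<open>Roots of a product add up as multisets only for nonzero factors; characteristic
    polynomials are monic.\<close>
  have nz: "char_poly B \<noteq> 0" if "B \<in> carrier_mat k k" for B :: "complex mat" and k
    using degree_monic_char_poly[OF that] by auto
  have "graph_spectrum (semi_double G V1) =
      proots (char_poly (adjacency_matrix (map Inr us @ map Inl vs) (semi_double G V1)))"
    using us vs by (intro graph_spectrum_eq) (auto simp: distinct_map semi_double_def)
  also have "\<dots> = proots (char_poly (0\<^sub>m ?m ?m :: complex mat) *
      char_poly (complex_of_real (sqrt 2) \<cdot>\<^sub>m ?A))"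
    unfolding adjacency_matrix_semi_double[OF assms(2) us vs] doubled[symmetric]
    by (subst char_poly_duplicated_block[OF A _ _ RAT]) auto
  also have "\<dots> = replicate_mset ?m 0 +
      image_mset ((*) (complex_of_real (sqrt 2))) (proots (char_poly ?A))"
    using A nz[of "0\<^sub>m ?m ?m" ?m] nz[of "complex_of_real (sqrt 2) \<cdot>\<^sub>m ?A" "length vs"]
    by (simp add: proots_mult proots_char_poly_zero_mat proots_char_poly_smult[OF A])
  finally show ?thesis
    using graph_spectrum_eq[OF vs(2,1)] distinct_card[OF us(2)] us(1)
    by (simp add: add.commute)
qed

lemma card_pverts_semi_double:
  assumes "pair_graph G" "bipartition G V1 V2"
  shows "card (pverts (semi_double G V1)) = 2 * card V1 + card V2"
proof -
  interpret pair_graph G by fact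
  have G: "pverts G = V1 \<union> V2" "V1 \<inter> V2 = {}"
    using assms(2) by (auto simp: bipartition_def)
  then have fin: "finite V1" "finite V2"
    using finite_verts by auto
  have "card (pverts (semi_double G V1)) = card (Inl ` (V1 \<union> V2) :: ('a + 'a) set) +
      card (Inr ` V1 :: ('a + 'a) set)"
    unfolding semi_double_def using fin by (subst card_Un_disjoint[symmetric]) (auto simp: G)
  then show ?thesis
    using fin G(2) by (simp add: card_image card_Un_disjoint)
qed

theorem theorem4p3:
  fixes G :: "'a pair_pre_digraph" and V1 V2 :: "'a set" and n1 n2 D :: nat
  assumes "pair_graph G"
    and "Digraph_Component.connected (with_proj G)"
    and "bipartition G V1 V2"
    and "n1 = card V1" and "n2 = card V2"
    and "graph_diameter G = ereal (real D)" and "D \<ge> 2"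
  shows "card (pverts (semi_double G V1)) = 2 * n1 + n2 \<and>
         graph_diameter (semi_double G V1) = ereal (real D) \<and>
         graph_spectrum (semi_double G V1) =
           image_mset (\<lambda>l. complex_of_real (sqrt 2) * l) (graph_spectrum G)
           + replicate_mset n1 0"
proof -
  have "ereal 2 \<le> graph_diameter G"
    using assms(6,7) by simp
  then have "2 \<le> graph_diameter G" by simp
  then show ?thesis
    using card_pverts_semi_double[OF assms(1,3)] graph_diameter_semi_double[OF assms(1-3)]
      graph_spectrum_semi_double[OF assms(1,3)] assms(4-6)
    by simp
qed

end
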